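(* Let $A$ be a finite alphabet, let $T$ be the shift operator on $A^\infty$, let $\mathcal{B}$ be the Borel $\sigma$-algebra of $A^\infty$, and let $\mu$ be a measure on $(A^\infty,\mathcal{B})$. Then the following two statements are equivalent: (1) for all $X,Y\in\mathcal{B}$, $\lim_{N\to\infty} N^{-1}\sum_{k\le N-1}\mu(X\cap T^{-k}(Y))=\mu(X)\mu(Y)$; (2) for all $x,y\in A^*$, $\lim_{N\to\infty} N^{-1}\sum_{k\le N-1}\mu([x]\cap T^{-k}([y]))=\mu([x])\mu([y])$.
   Context: $A^*$ is the set of finite strings over $A$, and $A^\infty$ is the set of infinite sequences over $A$. For $y\in A^*$ the cylinder $[y]$ is the set of sequences in $A^\infty$ that extend $y$; the cylinders generate the Borel $\sigma$-algebra $\mathcal{B}$. The shift $T$ deletes the first element of a sequence. The index $k$ in the sums ranges over $0,\dots,N-1$.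
   Formalization: The measure μ is assumed to be finite (for instance a probability measure); for measures with infinite total mass the equivalence fails, e.g. for the counting measure on a countable dense set of sequences containing a non-periodic one. *)

theory Defs
  imports "HOL-Probability.Probability"
begin

text \<open>
  \<^term>\<open>lists A\<close> is the set of finite strings over the alphabet, \<^term>\<open>streams A\<close> the set of infinite
  sequences, and \<^term>\<open>stl\<close> the shift.  The cylinder of a string is the library's \<^term>\<open>sstart A y\<close>;
  the lemma \<open>sstart_eq_stake\<close> restates it as the set of sequences extending \<open>y\<close>.
\<close>

definition seq_topology :: "'a set \<Rightarrow> 'a stream topology" where
  "seq_topology A =
     pullback_topology (streams A) snth (product_topology (\<lambda>_. discrete_topology A) UNIV)"

text \<open>As usual with \<^term>\<open>sigma\<close>, only the \<open>\<sigma>\<close>-algebra of this measure space matters.\<close>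

definition seq_borel :: "'a set \<Rightarrow> 'a stream measure" where
  "seq_borel A = sigma (streams A) {U. openin (seq_topology A) U}"

lemma sstart_eq_stake:
  assumes "y \<in> lists A"
  shows "sstart A y = {s \<in> streams A. stake (length y) s = y}"
proof -
  have "s \<in> sstart A y \<longleftrightarrow> s \<in> streams A \<and> stake (length y) s = y" for s
  proof (cases "s \<in> streams A")
    case True
    then show ?thesis
      by (auto simp: sstart_eq list_eq_iff_nth_eq)
  next
    case False
    then show ?thesis
      using sstart_in_streams[OF assms] by auto
  qed
  then show ?thesis by blast
qed

lemma topspace_seq_topology: "topspace (seq_topology A) = streams A"
  by (auto simp: seq_topology_def topspace_pullback_topology streams_iff_snth PiE_iff)

lemma space_seq_borel: "space (seq_borel A) = streams A"
  by (simp add: seq_borel_def space_measure_of_conv)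

lemma openin_sstart:
  assumes "y \<in> lists A"
  shows "openin (seq_topology A) (sstart A y)"
proof -
  define U where "U = (\<lambda>i. if i < length y then {y ! i} else A)"
  have "{i. U i \<noteq> A} \<subseteq> {..<length y}"
    by (auto simp: U_def split: if_splits)
  then have "finite {i. U i \<noteq> A}"
    by (rule finite_subset) simp
  moreover have "y ! i \<in> A" if "i < length y" for i
    using assms that by auto
  ultimately have "openin (product_topology (\<lambda>_. discrete_topology A) UNIV) (Pi\<^sub>E UNIV U)"
    by (auto simp: openin_PiE_gen U_def)
  moreover have "sstart A y = snth -` Pi\<^sub>E UNIV U \<inter> streams A"
    using sstart_in_streams[OF assms]
    by (auto simp: U_def PiE_iff sstart_eq snth_in subset_iff split: if_splits)
  ultimately show ?thesis
    by (auto simp: seq_topology_def openin_pullback_topology)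
qed

lemma openin_seq_topology_contains_sstart:
  assumes "openin (seq_topology A) V" "s \<in> V"
  obtains n where "sstart A (stake n s) \<subseteq> V"
proof -
  let ?P = "product_topology (\<lambda>_::nat. discrete_topology A) UNIV"
  obtain W where W: "openin ?P W" "V = snth -` W \<inter> streams A"
    using assms(1) by (auto simp: seq_topology_def openin_pullback_topology)
  have "snth s \<in> W" and s: "s \<in> streams A"
    using assms(2) W(2) by auto
  then obtain U where U: "finite {i. U i \<noteq> A}" "\<And>i. U i \<subseteq> A"
      "snth s \<in> Pi\<^sub>E UNIV U" "Pi\<^sub>E UNIV U \<subseteq> W"
    using W(1) unfolding openin_product_topology_alt by force
  obtain n where n: "\<And>i. U i \<noteq> A \<Longrightarrow> i < n"
    using finite_nat_bounded[OF U(1)] by blast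
  have stake: "stake n s \<in> lists A"
    using s by (auto simp: set_conv_nth snth_in)
  have "t \<in> V" if "t \<in> sstart A (stake n s)" for t
  proof -
    have t: "t \<in> streams A"
      using that sstart_in_streams[OF stake] by auto
    have eq: "t !! i = s !! i" if "i < n" for i
      using \<open>t \<in> sstart A (stake n s)\<close> t that by (simp add: sstart_eq)
    have "t !! i \<in> U i" for i
    proof (cases "U i = A")
      case True
      then show ?thesis using t by (simp add: snth_in)
    next
      case False
      then show ?thesis using eq[OF n] U(3) by (simp add: PiE_iff)
    qed
    then show ?thesis
      using U(4) t W(2) by (auto simp: PiE_iff)
  qed
  then show ?thesis by (intro that) blast
qed

lemma sets_seq_borel_sstart:
  assumes "countable A"
  shows "sets (seq_borel A) = sigma_sets (streams A) (sstart A ` lists A)"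
proof -
  have "{U. openin (seq_topology A) U} \<subseteq> Pow (streams A)"
    using openin_subset by (fastforce simp: topspace_seq_topology)
  then have "sets (seq_borel A) = sigma_sets (streams A) {U. openin (seq_topology A) U}"
    by (simp add: seq_borel_def)
  also have "\<dots> = sigma_sets (streams A) (sstart A ` lists A)"
  proof (rule sigma_sets_eqI)
    fix V assume "V \<in> {U. openin (seq_topology A) U}"
    then have V: "openin (seq_topology A) V" by simp
    let ?C = "{sstart A y | y. y \<in> lists A \<and> sstart A y \<subseteq> V}"
    have "V \<subseteq> \<Union>?C"
    proof
      fix s assume s: "s \<in> V"
      then have sA: "s \<in> streams A"
        using openin_subset[OF V] by (auto simp: topspace_seq_topology)
      obtain n where n: "sstart A (stake n s) \<subseteq> V"
        using openin_seq_topology_contains_sstart[OF V s] .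
      have "stake n s \<in> lists A"
        using sA by (auto simp: set_conv_nth snth_in)
      moreover have "s \<in> sstart A (stake n s)"
        using sA by (simp add: sstart_eq)
      ultimately show "s \<in> \<Union>?C" using n by blast
    qed
    then have "V = \<Union>?C" by auto
    moreover have "countable ?C"
      by (rule countable_subset[of _ "sstart A ` lists A"]) (use assms in auto)
    then have "\<Union>?C \<in> sigma_sets (streams A) (sstart A ` lists A)"
      by (rule sigma_sets_UNION) blast
    ultimately show "V \<in> sigma_sets (streams A) (sstart A ` lists A)" by simp
  next
    fix V assume "V \<in> sstart A ` lists A"
    then show "V \<in> sigma_sets (streams A) {U. openin (seq_topology A) U}"
      by (intro sigma_sets.Basic) (auto intro!: openin_sstart)
  qed
  finally show ?thesis .
qed

lemma sets_seq_borel_stream_space: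
  assumes "countable A"
  shows "sets (seq_borel A) = sets (stream_space (count_space A))"
proof -
  have sub: "sstart A ` lists A \<union> {{}} \<subseteq> Pow (streams A)"
    by (auto dest: sstart_in_streams del: in_listsD)
  have "sigma_sets (streams A) (sstart A ` lists A \<union> {{}}) = sigma_sets (streams A) (sstart A ` lists A)"
    by (rule sigma_sets_eqI) (auto intro: sigma_sets.Basic sigma_sets.Empty)
  then show ?thesis
    using sub by (simp add: sets_stream_space_sstart[OF assms] sets_seq_borel_sstart[OF assms] sets_measure_of)
qed

end

theory Submission
  imports Defs
begin

text \<open>
  Statement (2) already forces \<open>\<mu>\<close> to be shift invariant.  Let \<open>\<Omega> = A\<^sup>\<infinity>\<close> and \<open>x\<close> be empty.  Since \<open>A\<close>
  is finite, \<open>T\<^sup>-\<^sup>1[y]\<close> is a finite disjoint union of cylinders \<open>[ay]\<close>, so the averages of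
  \<open>\<mu>(T\<^sup>-\<^sup>k\<^sup>-\<^sup>1[y])\<close> tend to \<open>\<mu>(\<Omega>) \<mu>(T\<^sup>-\<^sup>1[y])\<close>; but they differ from those of \<open>\<mu>(T\<^sup>-\<^sup>k[y])\<close>, which
  tend to \<open>\<mu>(\<Omega>) \<mu>([y])\<close>, by \<open>O(1/N)\<close>, and one may assume \<open>\<mu>(\<Omega>) \<noteq> 0\<close>.
  Invariance bounds the average at \<open>(X, Y)\<close> by both \<open>\<mu>(X)\<close> and \<open>\<mu>(Y)\<close>.  By dominated
  convergence the sets satisfying the limit relation in one argument then form a Dynkin system,
  and the \<open>\<pi>\<close>-\<open>\<lambda>\<close> theorem applies to each argument in turn.
\<close>

lemma (in finite_measure) tendsto_measure_pi_system:
  fixes \<nu> :: "nat \<Rightarrow> 'a set \<Rightarrow> real"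
  assumes G: "Int_stable G" "G \<subseteq> Pow (space M)" "sets M = sigma_sets (space M) G"
    and additive: "\<And>N E. disjoint_family E \<Longrightarrow> range E \<subseteq> sets M \<Longrightarrow>
      (\<lambda>i. \<nu> N (E i)) sums \<nu> N (\<Union>i. E i)"
    and nonneg: "\<And>N X. X \<in> sets M \<Longrightarrow> 0 \<le> \<nu> N X"
    and bound: "\<And>N X. X \<in> sets M \<Longrightarrow> \<nu> N X \<le> measure M X"
    and lim_G: "\<And>X. X \<in> G \<Longrightarrow> (\<lambda>N. \<nu> N X) \<longlonglongrightarrow> c * measure M X"
    and lim_space: "(\<lambda>N. \<nu> N (space M)) \<longlonglongrightarrow> c * measure M (space M)"
    and X: "X \<in> sets M"
  shows "(\<lambda>N. \<nu> N X) \<longlonglongrightarrow> c * measure M X"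
proof -
  have empty: "\<nu> N {} = 0" for N
    using nonneg[of "{}" N] bound[of "{}" N] by simp
  have compl: "\<nu> N (space M - E) = \<nu> N (space M) - \<nu> N E" if E: "E \<in> sets M" for N E
  proof -
    have "disjoint_family (binaryset E (space M - E))"
      by (auto simp: disjoint_family_on_def binaryset_def)
    moreover have "range (binaryset E (space M - E)) \<subseteq> sets M"
      using E by (auto simp: range_binaryset_eq)
    ultimately have "(\<lambda>i. \<nu> N (binaryset E (space M - E) i)) sums \<nu> N (E \<union> (space M - E))"
      using additive[of "binaryset E (space M - E)" N] by (simp add: UN_binaryset_eq)
    moreover have "(\<lambda>i. \<nu> N (binaryset E (space M - E) i)) sums (\<nu> N E + \<nu> N (space M - E))"
      by (rule binaryset_sums) (rule empty)
    moreover have "E \<union> (space M - E) = space M"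
      using sets.sets_into_space[OF E] by blast
    ultimately show ?thesis
      using sums_unique2 by fastforce
  qed
  have "X \<in> sigma_sets (space M) G"
    using X G(3) by simp
  with G(1,2) show ?thesis
  proof (induction rule: sigma_sets_induct_disjoint)
    case (basic E)
    then show ?case by (rule lim_G)
  next
    case empty
    then show ?case using \<open>\<And>N. \<nu> N {} = 0\<close> by simp
  next
    case (compl E)
    then have "E \<in> sets M" by (simp add: G(3))
    then show ?case
      using tendsto_diff[OF lim_space compl.IH] \<open>\<And>N E. E \<in> sets M \<Longrightarrow> \<nu> N (space M - E) = _\<close>
      by (simp add: finite_measure_compl right_diff_distrib)
  next
    case (union E)
    have E: "range E \<subseteq> sets M" using union by (simp add: G(3))
    then have Ei: "E i \<in> sets M" for i by auto
    have sums: "(\<lambda>i. measure M (E i)) sums measure M (\<Union>i. E i)"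
      using E union by (intro finite_measure_UNION)
    have "(\<lambda>N. \<Sum>i. \<nu> N (E i)) \<longlonglongrightarrow> (\<Sum>i. c * measure M (E i))"
      by (rule tannerys_theorem[where M = "\<lambda>i. measure M (E i)", THEN conjunct2, THEN conjunct2])
        (use union.IH sums nonneg bound Ei in \<open>auto simp: sums_iff intro!: always_eventually\<close>)
    moreover have "(\<Sum>i. \<nu> N (E i)) = \<nu> N (\<Union>i. E i)" for N
      using additive[OF _ E, of N] union by (simp add: sums_iff)
    moreover have "(\<Sum>i. c * measure M (E i)) = c * measure M (\<Union>i. E i)"
      using sums_mult[OF sums, of c] by (simp add: sums_iff)
    ultimately show ?case by simp
  qed
qed

lemma measurable_funpow:
  assumes "T \<in> measurable M M"
  shows "T ^^ k \<in> measurable M M"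
  using assms by (induction k) (auto simp: id_def comp_def intro: measurable_compose)

lemma measure_funpow_vimage:
  assumes T: "T \<in> measurable M M" "distr M M T = M" and Y: "Y \<in> sets M"
  shows "measure M ((T ^^ k) -` Y \<inter> space M) = measure M Y"
proof -
  have "distr M M (T ^^ k) = M"
  proof (induction k)
    case (Suc k)
    then show ?case
      using distr_distr[OF T(1) measurable_funpow[OF T(1), of k]] T(2) by (simp add: comp_def)
  qed (simp add: id_def distr_id)
  then show ?thesis
    using measure_distr[OF measurable_funpow[OF T(1)] Y, of k] by simp
qed

lemma (in finite_measure) mixing_averages_pi_system:
  fixes T :: "'a \<Rightarrow> 'a"
  assumes G: "Int_stable G" "G \<subseteq> Pow (space M)" "sets M = sigma_sets (space M) G" "space M \<in> G"
    and T: "T \<in> measurable M M" "distr M M T = M"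
    and lim: "\<And>X Y. X \<in> G \<Longrightarrow> Y \<in> G \<Longrightarrow>
      (\<lambda>N. (\<Sum>k<N. measure M (X \<inter> (T ^^ k) -` Y)) / real N) \<longlonglongrightarrow> measure M X * measure M Y"
    and X: "X \<in> sets M" and Y: "Y \<in> sets M"
  shows "(\<lambda>N. (\<Sum>k<N. measure M (X \<inter> (T ^^ k) -` Y)) / real N) \<longlonglongrightarrow> measure M X * measure M Y"
proof -
  have GM: "E \<in> sets M" if "E \<in> G" for E
    using that by (simp add: G(3) sigma_sets.Basic)
  have vimage: "E \<inter> (T ^^ k) -` F \<in> sets M" if "E \<in> sets M" "F \<in> sets M" for E F k
  proof -
    have "E \<inter> (T ^^ k) -` F = E \<inter> ((T ^^ k) -` F \<inter> space M)"
      using sets.sets_into_space[OF that(1)] by blast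
    then show ?thesis
      using that measurable_sets[OF measurable_funpow[OF T(1)], of F k] by auto
  qed
  have average_le: "(\<Sum>k<N. f k) / real N \<le> c" if "\<And>k. f k \<le> c" "0 \<le> c"
    for f :: "nat \<Rightarrow> real" and c N
    using sum_bounded_above[of "{..<N}" f c] that by (cases "N = 0") (auto simp: field_simps)
  have le_left: "measure M (E \<inter> (T ^^ k) -` F) \<le> measure M E" if "E \<in> sets M" for E F k
    using that by (intro finite_measure_mono) auto
  have le_right: "measure M (E \<inter> (T ^^ k) -` F) \<le> measure M F"
    if "E \<in> sets M" "F \<in> sets M" for E F k
  proof -
    have "measure M (E \<inter> (T ^^ k) -` F) \<le> measure M ((T ^^ k) -` F \<inter> space M)"
      using that sets.sets_into_space measurable_sets[OF measurable_funpow[OF T(1)]]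
      by (intro finite_measure_mono) auto
    then show ?thesis
      using measure_funpow_vimage[OF T that(2)] by simp
  qed
  have lim_left: "(\<lambda>N. (\<Sum>k<N. measure M (E \<inter> (T ^^ k) -` F)) / real N)
      \<longlonglongrightarrow> measure M F * measure M E" if E: "E \<in> sets M" and F: "F \<in> G" for E F
  proof (rule tendsto_measure_pi_system[OF G(1-3) _ _ _ _ _ E])
    fix N and D :: "nat \<Rightarrow> 'a set" assume D: "disjoint_family D" "range D \<subseteq> sets M"
    have "(\<lambda>i. measure M (D i \<inter> (T ^^ k) -` F)) sums measure M (\<Union>i. D i \<inter> (T ^^ k) -` F)" for k
      using D vimage GM[OF F] by (intro finite_measure_UNION) (auto simp: disjoint_family_on_def)
    then show "(\<lambda>i. (\<Sum>k<N. measure M (D i \<inter> (T ^^ k) -` F)) / real N) sums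
        ((\<Sum>k<N. measure M ((\<Union>i. D i) \<inter> (T ^^ k) -` F)) / real N)"
      unfolding Int_UN_distrib2[symmetric] UN_extend_simps by (intro sums_divide sums_sum) simp
  qed (use lim[OF _ F] G(4) in \<open>auto simp: mult.commute[of "measure M F"] 
      intro!: average_le le_left sum_nonneg divide_nonneg_nonneg\<close>)
  show ?thesis
  proof (rule tendsto_measure_pi_system[OF G(1-3) _ _ _ _ _ Y])
    fix N and D :: "nat \<Rightarrow> 'a set" assume D: "disjoint_family D" "range D \<subseteq> sets M"
    have "(\<lambda>i. measure M (X \<inter> (T ^^ k) -` D i)) sums measure M (\<Union>i. X \<inter> (T ^^ k) -` D i)" for k
      using D vimage X by (intro finite_measure_UNION) (auto simp: disjoint_family_on_def)
    then show "(\<lambda>i. (\<Sum>k<N. measure M (X \<inter> (T ^^ k) -` D i)) / real N) sums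
        ((\<Sum>k<N. measure M (X \<inter> (T ^^ k) -` (\<Union>i. D i))) / real N)"
      unfolding vimage_UN Int_UN_distrib by (intro sums_divide sums_sum) simp
  qed (use lim_left[OF X] G(4) X in \<open>auto simp: mult.commute[of "measure M X"] 
      intro!: average_le le_right sum_nonneg divide_nonneg_nonneg\<close>)
qed

lemma stl_funpow_in_streams: "s \<in> streams A \<Longrightarrow> (stl ^^ k) s \<in> streams A"
  by (induction k) (auto intro: streams_stl)

lemma stl_vimage_sstart: "streams A \<inter> stl -` sstart A y = (\<Union>a\<in>A. sstart A (a # y))"
  if "y \<in> lists A"
proof -
  have "s \<in> streams A \<and> stl s \<in> sstart A y \<longleftrightarrow> shd s \<in> A \<and> stl s \<in> sstart A y" for s
    using sstart_in_streams[OF that] streams_Stream[of "shd s" "stl s" A] by auto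
  then show ?thesis by (auto simp: set_eq_iff)
qed

lemma measurable_stl_seq_borel:
  assumes "countable A" "sets \<mu> = sets (seq_borel A)"
  shows "stl \<in> measurable \<mu> \<mu>"
proof -
  have "sets \<mu> = sets (stream_space (count_space A))"
    using assms sets_seq_borel_stream_space by simp
  with measurable_stl[of "count_space A"] show ?thesis
    by (simp cong: measurable_cong_sets)
qed

lemma sstart_in_sets_seq_borel:
  assumes "countable A" "x \<in> lists A"
  shows "sstart A x \<in> sets (seq_borel A)"
  using assms by (simp add: sets_seq_borel_sstart sigma_sets.Basic)

theorem theorem9p1:
  fixes A :: "'a set" and \<mu> :: "'a stream measure"
  assumes "finite A"
    and "finite_measure \<mu>"
    and "sets \<mu> = sets (seq_borel A)"
  shows "(\<forall>X\<in>sets (seq_borel A). \<forall>Y\<in>sets (seq_borel A).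
            (\<lambda>N. (\<Sum>k<N. measure \<mu> (X \<inter> (stl ^^ k) -` Y)) / real N)
              \<longlonglongrightarrow> measure \<mu> X * measure \<mu> Y)
     \<longleftrightarrow>
         (\<forall>x\<in>lists A. \<forall>y\<in>lists A.
            (\<lambda>N. (\<Sum>k<N. measure \<mu> (sstart A x \<inter> (stl ^^ k) -` sstart A y)) / real N)
              \<longlonglongrightarrow> measure \<mu> (sstart A x) * measure \<mu> (sstart A y))"
proof (intro iffI ballI)
  fix x y assume "x \<in> lists A" "y \<in> lists A"
  moreover assume "\<forall>X\<in>sets (seq_borel A). \<forall>Y\<in>sets (seq_borel A).
            (\<lambda>N. (\<Sum>k<N. measure \<mu> (X \<inter> (stl ^^ k) -` Y)) / real N)
              \<longlonglongrightarrow> measure \<mu> X * measure \<mu> Y"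
  ultimately show "(\<lambda>N. (\<Sum>k<N. measure \<mu> (sstart A x \<inter> (stl ^^ k) -` sstart A y)) / real N)
              \<longlonglongrightarrow> measure \<mu> (sstart A x) * measure \<mu> (sstart A y)"
    using sstart_in_sets_seq_borel countable_finite[OF assms(1)] by blast
next
  fix X Y assume X: "X \<in> sets (seq_borel A)" and Y: "Y \<in> sets (seq_borel A)"
  assume lim: "\<forall>x\<in>lists A. \<forall>y\<in>lists A.
            (\<lambda>N. (\<Sum>k<N. measure \<mu> (sstart A x \<inter> (stl ^^ k) -` sstart A y)) / real N)
              \<longlonglongrightarrow> measure \<mu> (sstart A x) * measure \<mu> (sstart A y)"
  interpret finite_measure \<mu> by fact
  have A: "countable A" using assms(1) by (rule countable_finite)
  have space: "space \<mu> = streams A"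
    using sets_eq_imp_space_eq[OF assms(3)] by (simp add: space_seq_borel)
  have stl: "stl \<in> measurable \<mu> \<mu>"
    using A assms(3) by (rule measurable_stl_seq_borel)
  have cyl: "sstart A y \<in> sets \<mu>" if "y \<in> lists A" for y
    using sstart_in_sets_seq_borel[OF A that] assms(3) by simp
  define G where "G = sstart A ` lists A \<union> {{}}"
  have G: "Int_stable G" "G \<subseteq> Pow (space \<mu>)" "sets \<mu> = sigma_sets (space \<mu>) G" "space \<mu> \<in> G"
  proof -
    show "Int_stable G" unfolding G_def by (rule Int_stable_sstart)
    show sub: "G \<subseteq> Pow (space \<mu>)"
      by (auto simp: G_def space dest: sstart_in_streams del: in_listsD)
    show "sets \<mu> = sigma_sets (space \<mu>) G"
      using sub by (simp add: assms(3) sets_seq_borel_stream_space[OF A]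
          sets_stream_space_sstart[OF A] space G_def sets_measure_of)
    show "space \<mu> \<in> G"
      by (auto simp: G_def space intro!: image_eqI[where x="[]"])
  qed
  have invariant_cyl: "measure \<mu> (streams A \<inter> stl -` sstart A y) = measure \<mu> (sstart A y)"
    if y: "y \<in> lists A" for y
  proof (cases "measure \<mu> (streams A) = 0")
    case True
    have "measure \<mu> E = 0" if "E \<subseteq> streams A" for E
      using True measure_nonneg[of \<mu> E] that space bounded_measure[of E] by (metis order_antisym)
    then show ?thesis
      using sstart_in_streams[OF y] by simp
  next
    case False
    define u where "u k = measure \<mu> (streams A \<inter> (stl ^^ k) -` sstart A y)" for k
    have vimage: "streams A \<inter> (stl ^^ k) -` sstart A z \<in> sets \<mu>" if "z \<in> lists A" for k z
      using measurable_sets[OF measurable_funpow[OF stl] cyl[OF that], of k] by (simp add: space Int_commute)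
    have u_Suc: "u (Suc k) = (\<Sum>a\<in>A. measure \<mu> (streams A \<inter> (stl ^^ k) -` sstart A (a # y)))" for k
    proof -
      have "streams A \<inter> (stl ^^ Suc k) -` sstart A y
          = streams A \<inter> (stl ^^ k) -` (streams A \<inter> stl -` sstart A y)"
        by (auto intro: stl_funpow_in_streams)
      also have "\<dots> = (\<Union>a\<in>A. streams A \<inter> (stl ^^ k) -` sstart A (a # y))"
        unfolding stl_vimage_sstart[OF y] by auto
      finally have "u (Suc k) = measure \<mu> (\<Union>a\<in>A. streams A \<inter> (stl ^^ k) -` sstart A (a # y))"
        by (simp only: u_def)
      also have "\<dots> = (\<Sum>a\<in>A. measure \<mu> (streams A \<inter> (stl ^^ k) -` sstart A (a # y)))"
        using assms(1) y
        by (intro finite_measure_finite_Union) (auto simp: disjoint_family_on_def intro!: vimage)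
      finally show ?thesis .
    qed
    have meas_stl: "measure \<mu> (streams A \<inter> stl -` sstart A y) = (\<Sum>a\<in>A. measure \<mu> (sstart A (a # y)))"
      unfolding stl_vimage_sstart[OF y] using assms(1) y
      by (intro finite_measure_finite_Union) (auto simp: disjoint_family_on_def intro!: cyl)
    have lim_space: "(\<lambda>N. (\<Sum>k<N. measure \<mu> (streams A \<inter> (stl ^^ k) -` sstart A z)) / real N)
        \<longlonglongrightarrow> measure \<mu> (streams A) * measure \<mu> (sstart A z)" if "z \<in> lists A" for z
      using lim[rule_format, of "[]" z] that by simp
    have "(\<lambda>N. \<Sum>a\<in>A. (\<Sum>k<N. measure \<mu> (streams A \<inter> (stl ^^ k) -` sstart A (a # y))) / real N)
        \<longlonglongrightarrow> (\<Sum>a\<in>A. measure \<mu> (streams A) * measure \<mu> (sstart A (a # y)))"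
      using y by (intro tendsto_sum lim_space) auto
    moreover have "(\<Sum>a\<in>A. (\<Sum>k<N. measure \<mu> (streams A \<inter> (stl ^^ k) -` sstart A (a # y))) / real N)
        = (\<Sum>k<N. u (Suc k)) / real N" for N
      unfolding u_Suc sum_divide_distrib[symmetric] by (subst sum.swap) simp
    ultimately have shifted: "(\<lambda>N. (\<Sum>k<N. u (Suc k)) / real N)
        \<longlonglongrightarrow> measure \<mu> (streams A) * measure \<mu> (streams A \<inter> stl -` sstart A y)"
      by (simp add: meas_stl sum_distrib_left)
    have "(\<lambda>N. (u N - u 0) / real N) \<longlonglongrightarrow> 0"
    proof (rule Lim_null_comparison)
      show "\<forall>\<^sub>F N in sequentially. norm ((u N - u 0) / real N) \<le> measure \<mu> (space \<mu>) / real N"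
      proof (intro always_eventually allI)
        fix N
        have "\<bar>u N - u 0\<bar> \<le> measure \<mu> (space \<mu>)"
          using bounded_measure measure_nonneg unfolding u_def
          by (smt (verit, best))
        then show "norm ((u N - u 0) / real N) \<le> measure \<mu> (space \<mu>) / real N"
          by (simp add: divide_right_mono)
      qed
    qed (rule lim_const_over_n)
    moreover have "(\<Sum>k<N. u (Suc k)) / real N = (\<Sum>k<N. u k) / real N + (u N - u 0) / real N" for N
      using sum.lessThan_Suc_shift[of u N] by (simp add: add_divide_distrib[symmetric])
    ultimately have "(\<lambda>N. (\<Sum>k<N. u (Suc k)) / real N) \<longlonglongrightarrow> measure \<mu> (streams A) * measure \<mu> (sstart A y)"
      using tendsto_add[OF lim_space[OF y, folded u_def]] by fastforce
    from LIMSEQ_unique[OF shifted this] False show ?thesis by simp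
  qed
  have invariant: "distr \<mu> \<mu> stl = \<mu>"
  proof (rule measure_eqI_generator_eq[OF G(1,2), where A = "\<lambda>_. space \<mu>"])
    fix E assume "E \<in> G"
    then consider "E = {}" | y where "y \<in> lists A" "E = sstart A y"
      by (auto simp: G_def)
    then show "emeasure (distr \<mu> \<mu> stl) E = emeasure \<mu> E"
    proof cases
      case 2
      then show ?thesis
        using stl cyl invariant_cyl by (simp add: emeasure_distr emeasure_eq_measure space Int_commute)
    qed simp
  qed (use G(3,4) finite_measure.emeasure_finite[OF finite_measure_distr[OF stl]] in auto)
  show "(\<lambda>N. (\<Sum>k<N. measure \<mu> (X \<inter> (stl ^^ k) -` Y)) / real N) \<longlonglongrightarrow> measure \<mu> X * measure \<mu> Y"
  proof (rule mixing_averages_pi_system[OF G stl invariant])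
    fix E F assume "E \<in> G" "F \<in> G"
    then show "(\<lambda>N. (\<Sum>k<N. measure \<mu> (E \<inter> (stl ^^ k) -` F)) / real N) \<longlonglongrightarrow> measure \<mu> E * measure \<mu> F"
      using lim by (auto simp: G_def simp del: in_lists_conv_set del: in_listsD)
  qed (use X Y assms(3) in simp_all)
qed

end
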